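(* Let $(\mathcal A,I)$ be a hypergraph with the strong intersection property, and let $V$ be the free presheaf over a commutative field $\mathbb K$ generated by a product functor $E$ on $\mathcal A$. Then $V$ satisfies condition (G): for all $\alpha,\beta\in\mathcal A$ with $\alpha\to\beta$, $$V_{\alpha\beta}\cap\Big(\sum_{\gamma:\ \alpha\xrightarrow{\neq}\gamma,\ \gamma\not\to\beta}V_{\alpha\gamma}\Big)\subseteq\sum_{\gamma:\ \alpha\xrightarrow{\neq}\gamma,\ \beta\xrightarrow{\neq}\gamma}V_{\alpha\gamma}.$$
   Context: Hypergraph: $I$ is a set (not necessarily finite) and $\mathcal A$ is a set of finite subsets of $I$, viewed as a poset category with an arrow $\alpha\to\beta$ iff $\beta\subseteq\alpha$; $\alpha\xrightarrow{\neq}\beta$ means $\beta\subsetneq\alpha$, and $\gamma\not\to\beta$ means $\beta\not\subseteq\gamma$. In the sums, $\gamma$ ranges over elements of $\mathcal A$. Strong intersection property: $\alpha\cap\alpha'\in\mathcal A$ for all $\alpha,\alpha'\in\mathcal A$. Product functor: given non-empty sets $E_i$, $i\in I$, $E$ is the covariant functor on $\mathcal A$ with $E_\alpha=\prod_{i\in\alpha}E_i$ (a singleton if $\alpha=\emptyset$), the maps $\pi^{\beta\alpha}:E_\alpha\to E_\beta$ for $\beta\subseteq\alpha$ being the (surjective) coordinate projections. Free presheaf: $V_\alpha=\mathbb K^{E_\alpha}$ is the space of all functions $E_\alpha\to\mathbb K$, with injective maps $j_{\alpha\beta}:V_\beta\to V_\alpha$, $f\mapsto f\circ\pi^{\beta\alpha}$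 for $\alpha\to\beta$, and $V_{\alpha\beta}=j_{\alpha\beta}(V_\beta)$. *)

theory Defs
  imports Complex_Main "HOL-Library.FuncSet" "HOL-Library.Function_Algebras"
begin

definition hypergraph :: "'i set \<Rightarrow> 'i set set \<Rightarrow> bool" where
  "hypergraph I \<A> \<longleftrightarrow> (\<forall>\<alpha>\<in>\<A>. finite \<alpha> \<and> \<alpha> \<subseteq> I)"

definition strong_intersection :: "'i set set \<Rightarrow> bool" where
  "strong_intersection \<A> \<longleftrightarrow> (\<forall>\<alpha>\<in>\<A>. \<forall>\<alpha>'\<in>\<A>. \<alpha> \<inter> \<alpha>' \<in> \<A>)"

text \<open>The factors \<open>E i\<close> are arbitrary subsets of one ambient type.  A point of the product over
  \<open>\<alpha>\<close> is a function extended by \<open>undefined\<close> outside \<open>\<alpha>\<close>, so the product over the empty set is a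
  singleton.  The projection onto the product over \<open>\<beta>\<close> is the same operation for every source
  \<open>\<alpha> \<supseteq> \<beta>\<close>.\<close>

definition prod_obj :: "('i \<Rightarrow> 'e set) \<Rightarrow> 'i set \<Rightarrow> ('i \<Rightarrow> 'e) set" where
  "prod_obj E \<alpha> = Pi\<^sub>E \<alpha> E"

definition prod_proj :: "'i set \<Rightarrow> ('i \<Rightarrow> 'e) \<Rightarrow> ('i \<Rightarrow> 'e)" where
  "prod_proj \<beta> x = restrict x \<beta>"

text \<open>A function on the product over \<open>\<alpha>\<close> is represented by its extension by \<open>0\<close> (not by
  \<open>undefined\<close>), so that the pointwise operations on functions are the vector space operations.\<close>

definition free_space :: "('i \<Rightarrow> 'e set) \<Rightarrow> 'i set \<Rightarrow> (('i \<Rightarrow> 'e) \<Rightarrow> 'k::field) set" where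
  "free_space E \<alpha> = {f. \<forall>x. x \<notin> prod_obj E \<alpha> \<longrightarrow> f x = 0}"

definition free_map ::
    "('i \<Rightarrow> 'e set) \<Rightarrow> 'i set \<Rightarrow> 'i set \<Rightarrow> (('i \<Rightarrow> 'e) \<Rightarrow> 'k::field) \<Rightarrow> (('i \<Rightarrow> 'e) \<Rightarrow> 'k)" where
  "free_map E \<alpha> \<beta> f = (\<lambda>x. if x \<in> prod_obj E \<alpha> then f (prod_proj \<beta> x) else 0)"

lemma vector_space_fun: "vector_space (\<lambda>(c::'k::field) f (x::'x). c * f x)"
  by unfold_locales (auto simp: fun_eq_iff algebra_simps)

lemma subspace_free_space:
  "module.subspace (\<lambda>(c::'k::field) f x. c * f x) (free_space E \<alpha>)"
proof -
  interpret vector_space "\<lambda>(c::'k::field) f (x::'a \<Rightarrow> 'b). c * f x"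
    by (rule vector_space_fun)
  show ?thesis
    by (auto simp: subspace_def free_space_def)
qed

lemma free_map_add: "free_map E \<alpha> \<beta> (f + g) = free_map E \<alpha> \<beta> f + free_map E \<alpha> \<beta> g"
  by (auto simp: free_map_def fun_eq_iff)

lemma free_map_scale: "free_map E \<alpha> \<beta> (\<lambda>x. c * f x) = (\<lambda>x. c * free_map E \<alpha> \<beta> f x)"
  by (auto simp: free_map_def fun_eq_iff)

lemma free_map_in_free_space: "free_map E \<alpha> \<beta> f \<in> free_space E \<alpha>"
  by (auto simp: free_map_def free_space_def)

lemma free_map_id: "f \<in> free_space E \<alpha> \<Longrightarrow> free_map E \<alpha> \<alpha> f = f"
  by (auto simp: free_map_def free_space_def prod_obj_def prod_proj_def fun_eq_iff
      PiE_restrict)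

lemma free_map_comp:
  assumes "\<beta> \<subseteq> \<alpha>" "\<gamma> \<subseteq> \<beta>"
  shows "free_map E \<alpha> \<beta> (free_map E \<beta> \<gamma> f) = free_map E \<alpha> \<gamma> f"
proof -
  have "restrict x \<beta> \<in> Pi\<^sub>E \<beta> E" if "x \<in> Pi\<^sub>E \<alpha> E" for x
    using that assms by (auto simp: PiE_iff)
  moreover have "\<beta> \<inter> \<gamma> = \<gamma>"
    using assms by auto
  ultimately show ?thesis
    by (auto simp: free_map_def prod_obj_def prod_proj_def fun_eq_iff)
qed

lemma prod_proj_surj:
  assumes "\<beta> \<subseteq> \<alpha>" "\<And>i. i \<in> \<alpha> \<Longrightarrow> E i \<noteq> {}"
  shows "prod_proj \<beta> ` prod_obj E \<alpha> = prod_obj E \<beta>"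
proof
  show "prod_proj \<beta> ` prod_obj E \<alpha> \<subseteq> prod_obj E \<beta>"
    using assms(1) by (auto simp: prod_obj_def prod_proj_def PiE_iff)
  show "prod_obj E \<beta> \<subseteq> prod_proj \<beta> ` prod_obj E \<alpha>"
  proof
    fix y assume y: "y \<in> prod_obj E \<beta>"
    define x where
      "x = restrict (\<lambda>i. if i \<in> \<beta> then y i else (SOME e. e \<in> E i)) \<alpha>"
    have "x \<in> prod_obj E \<alpha>"
      using y assms(2) by (auto simp: x_def prod_obj_def PiE_iff some_in_eq)
    moreover have "prod_proj \<beta> x = y"
      using y assms(1)
      by (auto simp: x_def prod_obj_def prod_proj_def PiE_iff extensional_def fun_eq_iff)
    ultimately show "y \<in> prod_proj \<beta> ` prod_obj E \<alpha>"
      by blast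
  qed
qed

lemma free_map_inj:
  assumes "\<beta> \<subseteq> \<alpha>" "\<And>i. i \<in> \<alpha> \<Longrightarrow> E i \<noteq> {}"
  shows "inj_on (free_map E \<alpha> \<beta>) (free_space E \<beta>)"
proof (rule inj_onI)
  fix f g :: "('a \<Rightarrow> 'b) \<Rightarrow> 'c"
  assume fg: "f \<in> free_space E \<beta>" "g \<in> free_space E \<beta>"
    and eq: "free_map E \<alpha> \<beta> f = free_map E \<alpha> \<beta> g"
  show "f = g"
  proof
    fix y
    show "f y = g y"
    proof (cases "y \<in> prod_obj E \<beta>")
      case True
      then obtain x where "x \<in> prod_obj E \<alpha>" "y = prod_proj \<beta> x"
        using prod_proj_surj[of \<beta> \<alpha> E] assms by blast
      then show ?thesis
        using fun_cong[OF eq, of x] by (simp add: free_map_def)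
    next
      case False
      then show ?thesis
        using fg by (simp add: free_space_def)
    qed
  qed
qed

text \<open>The sum of a family of subspaces (or additive subgroups) is the set of its finite sums;
  it is \<open>{0}\<close> for the empty family.\<close>

definition subspace_sum :: "('s \<Rightarrow> 'v::comm_monoid_add set) \<Rightarrow> 's set \<Rightarrow> 'v set" where
  "subspace_sum W S = {\<Sum>\<gamma>\<in>F. f \<gamma> | F f. finite F \<and> F \<subseteq> S \<and> (\<forall>\<gamma>\<in>F. f \<gamma> \<in> W \<gamma>)}"

text \<open>Here \<open>j \<alpha> \<beta>\<close>, for \<open>\<beta> \<subseteq> \<alpha>\<close>, is the presheaf map from \<open>V \<beta>\<close> to \<open>V \<alpha>\<close>.\<close>

definition presheaf_image ::
    "('i set \<Rightarrow> 'v set) \<Rightarrow> ('i set \<Rightarrow> 'i set \<Rightarrow> 'v \<Rightarrow> 'v) \<Rightarrow> 'i set \<Rightarrow> 'i set \<Rightarrow> 'v set" where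
  "presheaf_image V j \<alpha> \<beta> = j \<alpha> \<beta> ` V \<beta>"

definition condition_G ::
    "'i set set \<Rightarrow> ('i set \<Rightarrow> 'v::comm_monoid_add set) \<Rightarrow>
     ('i set \<Rightarrow> 'i set \<Rightarrow> 'v \<Rightarrow> 'v) \<Rightarrow> bool" where
  "condition_G \<A> V j \<longleftrightarrow>
     (\<forall>\<alpha>\<in>\<A>. \<forall>\<beta>\<in>\<A>. \<beta> \<subseteq> \<alpha> \<longrightarrow>
        presheaf_image V j \<alpha> \<beta> \<inter>
          subspace_sum (presheaf_image V j \<alpha>) {\<gamma>\<in>\<A>. \<gamma> \<subset> \<alpha> \<and> \<not> \<beta> \<subseteq> \<gamma>}
        \<subseteq> subspace_sum (presheaf_image V j \<alpha>) {\<gamma>\<in>\<A>. \<gamma> \<subset> \<alpha> \<and> \<gamma> \<subset> \<beta>})"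

end

theory Submission imports Defs begin

text \<open>Choose a base point \<open>b i \<in> E i\<close> for every \<open>i \<in> \<alpha>\<close> and let \<open>T\<close> (\<open>reset_map\<close> below) precompose a function on the
  product over \<open>\<alpha>\<close> with the map that keeps the coordinates in \<open>\<beta>\<close> and resets the others to \<open>b\<close>.
  The operator \<open>T\<close> is additive, is the identity on \<open>V\<^bsub>\<alpha>\<beta>\<^esub>\<close>, and sends \<open>V\<^bsub>\<alpha>\<gamma>\<^esub>\<close> into the space for
  \<open>\<beta> \<inter> \<gamma>\<close>, which is an index in \<open>\<A>\<close> strictly below \<open>\<beta>\<close> as soon as \<open>\<beta>\<close> is not contained in \<open>\<gamma>\<close>.
  Applying \<open>T\<close> to a decomposition of an element of \<open>V\<^bsub>\<alpha>\<beta>\<^esub>\<close> gives the claim.\<close>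

text \<open>The index map \<open>k\<close> need not be injective: different \<gamma> may have the
  same intersection with \<beta>. The terms are therefore grouped along the fibres of
  \<open>k\<close>, and closure under addition turns each group into a single summand for its
  index.\<close>

lemma sum_in_subspace_sum:
  assumes F: "finite F" and k: "k ` F \<subseteq> S" and h: "\<And>\<gamma>. \<gamma> \<in> F \<Longrightarrow> h \<gamma> \<in> W (k \<gamma>)"
    and zero: "\<And>\<delta>. \<delta> \<in> S \<Longrightarrow> 0 \<in> W \<delta>"
    and add: "\<And>\<delta> u v. \<delta> \<in> S \<Longrightarrow> u \<in> W \<delta> \<Longrightarrow> v \<in> W \<delta> \<Longrightarrow> u + v \<in> W \<delta>"
  shows "(\<Sum>\<gamma>\<in>F. h \<gamma>) \<in> subspace_sum W S"
proof -
  have fibre: "(\<Sum>\<gamma>\<in>G. h \<gamma>) \<in> W \<delta>"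
    if "finite G" "\<delta> \<in> S" "\<And>\<gamma>. \<gamma> \<in> G \<Longrightarrow> h \<gamma> \<in> W \<delta>" for G \<delta>
    using that by (induction G rule: finite_induct) (auto intro: zero add)
  have "\<forall>\<delta>\<in>k ` F. (\<Sum>\<gamma>\<in>{\<gamma>\<in>F. k \<gamma> = \<delta>}. h \<gamma>) \<in> W \<delta>"
  proof
    fix \<delta> assume "\<delta> \<in> k ` F"
    then show "(\<Sum>\<gamma>\<in>{\<gamma>\<in>F. k \<gamma> = \<delta>}. h \<gamma>) \<in> W \<delta>"
      using F k by (intro fibre) (auto dest: h)
  qed
  moreover have "(\<Sum>\<gamma>\<in>F. h \<gamma>) = (\<Sum>\<delta>\<in>k ` F. \<Sum>\<gamma>\<in>{\<gamma>\<in>F. k \<gamma> = \<delta>}. h \<gamma>)"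
    by (rule sum.image_gen[OF F])
  moreover have "finite (k ` F)"
    using F by simp
  ultimately show ?thesis
    using k unfolding subspace_sum_def mem_Collect_eq
    by (intro exI[of _ "k ` F"] exI[of _ "\<lambda>\<delta>. \<Sum>\<gamma>\<in>{\<gamma>\<in>F. k \<gamma> = \<delta>}. h \<gamma>"] conjI)
qed

text \<open>A function on the product over \<alpha> descends along the surjective projection exactly
  when it is constant on the fibres. This replaces the search for a preimage by an equation between
  values.\<close>

lemma presheaf_image_free_iff:
  assumes "\<beta> \<subseteq> \<alpha>" "\<forall>i\<in>\<alpha>. E i \<noteq> {}"
  shows "h \<in> presheaf_image (free_space E) (free_map E) \<alpha> \<beta> \<longleftrightarrow>
    h \<in> free_space E \<alpha> \<and>
    (\<forall>x\<in>prod_obj E \<alpha>. \<forall>y\<in>prod_obj E \<alpha>. restrict x \<beta> = restrict y \<beta> \<longrightarrow> h x = h y)"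
    (is "_ \<longleftrightarrow> ?R")
proof
  assume "h \<in> presheaf_image (free_space E) (free_map E) \<alpha> \<beta>"
  then obtain g where "h = free_map E \<alpha> \<beta> g"
    unfolding presheaf_image_def by blast
  then show ?R
    by (simp add: free_map_def free_space_def prod_proj_def)
next
  assume R: ?R
  \<comment> \<open>A section of the projection; the value of \<open>h\<close> on it does not depend
    on the choice, since \<open>h\<close> is constant on fibres.\<close>
  define lift where "lift y = (SOME x. x \<in> prod_obj E \<alpha> \<and> prod_proj \<beta> x = y)" for y
  have lift: "lift y \<in> prod_obj E \<alpha> \<and> prod_proj \<beta> (lift y) = y" if "y \<in> prod_obj E \<beta>" for y
  proof -
    have "y \<in> prod_proj \<beta> ` prod_obj E \<alpha>"
      using prod_proj_surj[of \<beta> \<alpha> E] assms that by simp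
    then have "\<exists>x. x \<in> prod_obj E \<alpha> \<and> prod_proj \<beta> x = y"
      by blast
    then show ?thesis
      unfolding lift_def by (rule someI_ex)
  qed
  define g where "g = (\<lambda>y. if y \<in> prod_obj E \<beta> then h (lift y) else 0)"
  have "g \<in> free_space E \<beta>"
    by (simp add: g_def free_space_def)
  moreover have "free_map E \<alpha> \<beta> g = h"
  proof
    fix x
    show "free_map E \<alpha> \<beta> g x = h x"
    proof (cases "x \<in> prod_obj E \<alpha>")
      case True
      then have y: "prod_proj \<beta> x \<in> prod_obj E \<beta>"
        using assms(1) by (auto simp: prod_obj_def prod_proj_def PiE_iff)
      have "h (lift (prod_proj \<beta> x)) = h x"
        using R[THEN conjunct2, rule_format, of "lift (prod_proj \<beta> x)" x] lift[OF y] True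
        unfolding prod_proj_def by blast
      then show ?thesis
        using True y by (simp add: free_map_def g_def)
    next
      case False
      then show ?thesis
        using R by (simp add: free_map_def free_space_def)
    qed
  qed
  ultimately show "h \<in> presheaf_image (free_space E) (free_map E) \<alpha> \<beta>"
    unfolding presheaf_image_def by blast
qed

text \<open>The outer \<open>restrict\<close> keeps the value \<open>undefined\<close> outside
  \<alpha>, as points of the product over \<alpha> require.\<close>

definition reset :: "('i \<Rightarrow> 'e) \<Rightarrow> 'i set \<Rightarrow> 'i set \<Rightarrow> ('i \<Rightarrow> 'e) \<Rightarrow> ('i \<Rightarrow> 'e)" where
  "reset b \<alpha> \<beta> x = restrict (\<lambda>i. if i \<in> \<beta> then x i else b i) \<alpha>"

definition reset_map ::
    "('i \<Rightarrow> 'e set) \<Rightarrow> ('i \<Rightarrow> 'e) \<Rightarrow> 'i set \<Rightarrow> 'i set \<Rightarrow> (('i \<Rightarrow> 'e) \<Rightarrow> 'k::field) \<Rightarrow> (('i \<Rightarrow> 'e) \<Rightarrow> 'k)" where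
  "reset_map E b \<alpha> \<beta> h = (\<lambda>x. if x \<in> prod_obj E \<alpha> then h (reset b \<alpha> \<beta> x) else 0)"

lemma reset_in_prod_obj:
  assumes "x \<in> prod_obj E \<alpha>" "\<forall>i\<in>\<alpha>. b i \<in> E i"
  shows "reset b \<alpha> \<beta> x \<in> prod_obj E \<alpha>"
  using assms by (auto simp: reset_def prod_obj_def PiE_iff)

text \<open>A coordinate in \<gamma> of the reset point comes from the argument if it lies in
  \<beta>, and otherwise from \<open>b\<close>, which is common to both points.\<close>

lemma restrict_reset_cong:
  assumes "\<gamma> \<subseteq> \<alpha>" "restrict x (\<beta> \<inter> \<gamma>) = restrict y (\<beta> \<inter> \<gamma>)"
  shows "restrict (reset b \<alpha> \<beta> x) \<gamma> = restrict (reset b \<alpha> \<beta> y) \<gamma>"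
proof
  fix i
  show "restrict (reset b \<alpha> \<beta> x) \<gamma> i = restrict (reset b \<alpha> \<beta> y) \<gamma> i"
    using assms(1) fun_cong[OF assms(2), of i]
    by (auto simp: reset_def restrict_def)
qed

lemma restrict_reset_same:
  assumes "\<beta> \<subseteq> \<alpha>"
  shows "restrict (reset b \<alpha> \<beta> x) \<beta> = restrict x \<beta>"
  using assms by (auto simp: reset_def restrict_def fun_eq_iff)

lemma reset_map_sum: "reset_map E b \<alpha> \<beta> (\<Sum>\<gamma>\<in>F. h \<gamma>) = (\<Sum>\<gamma>\<in>F. reset_map E b \<alpha> \<beta> (h \<gamma>))"
proof -
  have zero: "reset_map E b \<alpha> \<beta> 0 = 0"
    by (simp add: reset_map_def fun_eq_iff)
  have add: "reset_map E b \<alpha> \<beta> (u + v) = reset_map E b \<alpha> \<beta> u + reset_map E b \<alpha> \<beta> v" for u v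
    by (simp add: reset_map_def fun_eq_iff)
  show ?thesis
    by (induction F rule: infinite_finite_induct) (simp_all only: sum.infinite sum.empty sum.insert zero add not_False_eq_True)
qed

text \<open>Resetting moves a point only within its fibre over the product over \<beta>, where
  \<open>h\<close> is constant.\<close>

lemma reset_map_ident:
  assumes "\<beta> \<subseteq> \<alpha>" "\<forall>i\<in>\<alpha>. b i \<in> E i"
    and "h \<in> presheaf_image (free_space E) (free_map E) \<alpha> \<beta>"
  shows "reset_map E b \<alpha> \<beta> h = h"
proof -
  have ne: "\<forall>i\<in>\<alpha>. E i \<noteq> {}"
    using assms(2) by blast
  have h: "h \<in> free_space E \<alpha>"
    "\<And>x y. x \<in> prod_obj E \<alpha> \<Longrightarrow> y \<in> prod_obj E \<alpha> \<Longrightarrow> restrict x \<beta> = restrict y \<beta> \<Longrightarrow> h x = h y"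
    using assms(3) unfolding presheaf_image_free_iff[OF assms(1) ne] by blast+
  have "h (reset b \<alpha> \<beta> x) = h x" if "x \<in> prod_obj E \<alpha>" for x
    using that assms(1,2) by (intro h(2) reset_in_prod_obj restrict_reset_same)
  then show ?thesis
    using h(1) by (simp add: reset_map_def free_space_def fun_eq_iff)
qed

lemma reset_map_in_presheaf_image:
  assumes "\<gamma> \<subseteq> \<alpha>" "\<forall>i\<in>\<alpha>. b i \<in> E i"
    and "h \<in> presheaf_image (free_space E) (free_map E) \<alpha> \<gamma>"
  shows "reset_map E b \<alpha> \<beta> h \<in> presheaf_image (free_space E) (free_map E) \<alpha> (\<beta> \<inter> \<gamma>)"
proof -
  have ne: "\<forall>i\<in>\<alpha>. E i \<noteq> {}"
    using assms(2) by blast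
  have h: "h x = h y"
    if "x \<in> prod_obj E \<alpha>" "y \<in> prod_obj E \<alpha>" "restrict x \<gamma> = restrict y \<gamma>" for x y
    using assms(3) that unfolding presheaf_image_free_iff[OF assms(1) ne] by blast
  have "\<beta> \<inter> \<gamma> \<subseteq> \<alpha>"
    using assms(1) by blast
  moreover have "reset_map E b \<alpha> \<beta> h x = reset_map E b \<alpha> \<beta> h y"
    if "x \<in> prod_obj E \<alpha>" "y \<in> prod_obj E \<alpha>" "restrict x (\<beta> \<inter> \<gamma>) = restrict y (\<beta> \<inter> \<gamma>)" for x y
  proof -
    have "h (reset b \<alpha> \<beta> x) = h (reset b \<alpha> \<beta> y)"
      using that assms(1,2) by (intro h reset_in_prod_obj restrict_reset_cong)
    then show ?thesis
      using that by (simp add: reset_map_def)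
  qed
  moreover have "reset_map E b \<alpha> \<beta> h \<in> free_space E \<alpha>"
    by (simp add: reset_map_def free_space_def)
  ultimately show ?thesis
    unfolding presheaf_image_free_iff[OF \<open>\<beta> \<inter> \<gamma> \<subseteq> \<alpha>\<close> ne] by blast
qed

theorem proposition5p4:
  fixes I :: "'i set" and \<A> :: "'i set set" and E :: "'i \<Rightarrow> 'e set"
  assumes "hypergraph I \<A>"
    and "strong_intersection \<A>"
    and "\<And>i. i \<in> I \<Longrightarrow> E i \<noteq> {}"
  shows "condition_G \<A>
    (free_space E :: 'i set \<Rightarrow> (('i \<Rightarrow> 'e) \<Rightarrow> 'k::field) set) (free_map E)"
  unfolding condition_G_def
proof (intro ballI impI subsetI)
  let ?W = "presheaf_image (free_space E :: 'i set \<Rightarrow> (('i \<Rightarrow> 'e) \<Rightarrow> 'k) set) (free_map E)"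
  fix \<alpha> \<beta> h
  assume \<alpha>: "\<alpha> \<in> \<A>" and \<beta>: "\<beta> \<in> \<A>" "\<beta> \<subseteq> \<alpha>"
    and h: "h \<in> ?W \<alpha> \<beta> \<inter> subspace_sum (?W \<alpha>) {\<gamma>\<in>\<A>. \<gamma> \<subset> \<alpha> \<and> \<not> \<beta> \<subseteq> \<gamma>}"
  have ne: "\<forall>i\<in>\<alpha>. E i \<noteq> {}"
    using assms(1,3) \<alpha> by (auto simp: hypergraph_def)
  \<comment> \<open>Outside \<alpha> the set \<open>E i\<close> may be empty and \<open>b i\<close>
    arbitrary; \<open>reset\<close> reads \<open>b\<close> only on \<alpha>.\<close>
  define b where "b i = (SOME e. e \<in> E i)" for i
  have b: "\<forall>i\<in>\<alpha>. b i \<in> E i"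
    using ne by (simp add: b_def some_in_eq)
  obtain F f where F: "finite F" "F \<subseteq> {\<gamma>\<in>\<A>. \<gamma> \<subset> \<alpha> \<and> \<not> \<beta> \<subseteq> \<gamma>}"
    and f: "\<forall>\<gamma>\<in>F. f \<gamma> \<in> ?W \<alpha> \<gamma>" and h_eq: "h = (\<Sum>\<gamma>\<in>F. f \<gamma>)"
    using h unfolding subspace_sum_def by blast
  \<comment> \<open>The left side is \<open>h\<close> itself because the operator fixes it; the
    right side is the operator distributed over the decomposition.\<close>
  have "h = (\<Sum>\<gamma>\<in>F. reset_map E b \<alpha> \<beta> (f \<gamma>))"
    using reset_map_ident[OF \<beta>(2) b, where h = h] h by (simp add: h_eq reset_map_sum)
  also have "\<dots> \<in> subspace_sum (?W \<alpha>) {\<gamma>\<in>\<A>. \<gamma> \<subset> \<alpha> \<and> \<gamma> \<subset> \<beta>}"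
  proof (rule sum_in_subspace_sum[where k = "\<lambda>\<gamma>. \<beta> \<inter> \<gamma>", OF F(1)])
    show "(\<lambda>\<gamma>. \<beta> \<inter> \<gamma>) ` F \<subseteq> {\<gamma>\<in>\<A>. \<gamma> \<subset> \<alpha> \<and> \<gamma> \<subset> \<beta>}"
      using F(2) \<beta>(1) assms(2) by (auto simp: strong_intersection_def)
    show "reset_map E b \<alpha> \<beta> (f \<gamma>) \<in> ?W \<alpha> (\<beta> \<inter> \<gamma>)" if "\<gamma> \<in> F" for \<gamma>
    proof (rule reset_map_in_presheaf_image[OF _ b])
      show "\<gamma> \<subseteq> \<alpha>" "f \<gamma> \<in> ?W \<alpha> \<gamma>"
        using F(2) f that by auto
    qed
  next
    fix \<delta> assume "\<delta> \<in> {\<gamma>\<in>\<A>. \<gamma> \<subset> \<alpha> \<and> \<gamma> \<subset> \<beta>}"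
    then have "\<delta> \<subseteq> \<alpha>"
      by blast
    \<comment> \<open>With this criterion, closure under zero and addition is checked on values,
      without combining preimages.\<close>
    then have iff: "u \<in> ?W \<alpha> \<delta> \<longleftrightarrow> u \<in> free_space E \<alpha> \<and>
      (\<forall>x\<in>prod_obj E \<alpha>. \<forall>y\<in>prod_obj E \<alpha>. restrict x \<delta> = restrict y \<delta> \<longrightarrow> u x = u y)" for u
      using ne by (rule presheaf_image_free_iff)
    show "0 \<in> ?W \<alpha> \<delta>"
      by (simp add: iff free_space_def)
    show "u + v \<in> ?W \<alpha> \<delta>" if "u \<in> ?W \<alpha> \<delta>" "v \<in> ?W \<alpha> \<delta>" for u v
      unfolding iff
    proof (intro conjI ballI impI)
      show "u + v \<in> free_space E \<alpha>"
        using that by (simp add: iff free_space_def)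
      fix x y assume "x \<in> prod_obj E \<alpha>" "y \<in> prod_obj E \<alpha>" "restrict x \<delta> = restrict y \<delta>"
      then have "u x = u y" "v x = v y"
        using that unfolding iff by blast+
      then show "(u + v) x = (u + v) y"
        by simp
    qed
  qed
  finally show "h \<in> subspace_sum (?W \<alpha>) {\<gamma>\<in>\<A>. \<gamma> \<subset> \<alpha> \<and> \<gamma> \<subset> \<beta>}" .
qed

end
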